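(* For every $n\in\mathbb{N}$, the number of real roots of the Yablonskii--Vorob'ev polynomial $Q_n$ equals $$|Z_n|=\left[\frac{n+1}{2}\right].$$ Furthermore, for every $n\geq 2$, $$\min(Z_{n-1})>\min(Z_{n+1}),\qquad \max(Z_{n-1})<\max(Z_{n+1}).$$
   Context: $\mathbb{N}=\{0,1,2,\ldots\}$. The Yablonskii--Vorob'ev polynomials $Q_n$ ($n\in\mathbb{N}$) are the polynomials in $z$ defined by $Q_0=1$, $Q_1=z$ and, for $n\ge 1$, the differential-difference equation $$Q_{n+1}Q_{n-1}=zQ_n^2-4\big(Q_nQ_n''-(Q_n')^2\big),$$ where $'$ denotes $d/dz$. (It is known that each $Q_n$ is a monic polynomial of degree $\tfrac12 n(n+1)$ with integer coefficients.) For $n\in\mathbb{N}$, $Z_n$ denotes the set of real roots of $Q_n$, and $|Z_n|$ is its cardinality. For a real number $x$, $[x]$ denotes the integer part of $x$. *)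

theory Defs
  imports Complex_Main "HOL-Computational_Algebra.Computational_Algebra"
    "HOL-Computational_Algebra.Field_as_Ring"
begin

definition yv_rhs :: "real poly \<Rightarrow> real poly" where
  "yv_rhs f = [:0, 1:] * f\<^sup>2 - 4 * (f * pderiv (pderiv f) - (pderiv f)\<^sup>2)"

text \<open>The division is exact: see \<open>yablonskii_vorobev_recurrence\<close> below, which together with
  the two initial values determines the sequence (\<open>yablonskii_vorobev_unique\<close>).\<close>

fun yablonskii_vorobev :: "nat \<Rightarrow> real poly" where
  "yablonskii_vorobev 0 = 1"
| "yablonskii_vorobev (Suc 0) = [:0, 1:]"
| "yablonskii_vorobev (Suc (Suc n)) =
     yv_rhs (yablonskii_vorobev (Suc n)) div yablonskii_vorobev n"

definition real_roots :: "nat \<Rightarrow> real set" where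
  "real_roots n = {x. poly (yablonskii_vorobev n) x = 0}"


subsection \<open>The recurrence holds without remainder\<close>

lemma pderiv_yv_rhs:
  "pderiv (yv_rhs f) = f\<^sup>2 + 2 * [:0, 1:] * f * pderiv f
     - 4 * (f * pderiv (pderiv (pderiv f)) - pderiv f * pderiv (pderiv f))"
proof -
  define z where "z = [:0, 1 :: real:]"
  have z: "pderiv z = 1" by (simp add: z_def pderiv_pCons one_pCons)
  have 4: "pderiv (4 :: real poly) = 0" using pderiv_of_nat[of 4] by simp
  show ?thesis
    unfolding yv_rhs_def z_def[symmetric]
    by (simp add: pderiv_diff pderiv_add pderiv_mult power2_eq_square z 4 algebra_simps)
qed

lemma pderiv2_yv_rhs:
  "pderiv (pderiv (yv_rhs f)) = 4 * f * pderiv f + 2 * [:0, 1:] * (pderiv f)\<^sup>2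
     + 2 * [:0, 1:] * f * pderiv (pderiv f)
     - 4 * (f * pderiv (pderiv (pderiv (pderiv f))) - (pderiv (pderiv f))\<^sup>2)"
proof -
  define z where "z = [:0, 1 :: real:]"
  have z: "pderiv z = 1" by (simp add: z_def pderiv_pCons one_pCons)
  have 4: "pderiv (4 :: real poly) = 0" using pderiv_of_nat[of 4] by simp
  have 2: "pderiv (2 :: real poly) = 0" using pderiv_of_nat[of 2] by simp
  show ?thesis
    unfolding pderiv_yv_rhs z_def[symmetric]
    by (simp add: pderiv_diff pderiv_add pderiv_mult power2_eq_square z 4 2 algebra_simps)
qed

lemma yv_identity1:
  fixes z f p q r a a1 a2 a3 k :: "'a::comm_ring_1"
  shows "f * (f * (a\<^sup>2 + 2*z*a*a1 - 4*(a*a3 - a1*a2)) - 2 * p * (z*a\<^sup>2 - 4*(a*a2 - a1\<^sup>2)) - (k + 2) * a\<^sup>2 * f)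
   + a * (a * (f\<^sup>2 + 2*z*f*p - 4*(f*r - p*q)) - 2 * a1 * (z*f\<^sup>2 - 4*(f*q - p\<^sup>2)) + k * f\<^sup>2 * a)
   = 4 * (q*a - 2*p*a1 + f*a2) * (a1*f + a*p) - 4 * (r*a - q*a1 - p*a2 + f*a3)*(a*f)"
  by (simp add: power2_eq_square algebra_simps)

lemma yv_identity2:
  fixes z f p q t1 t2 t3 t4 :: "'a::comm_ring_1"
  shows "4 * z * (4 * p\<^sup>2 + f * t1)\<^sup>2 - 8 * (4 * p\<^sup>2 + f * t1) * (2 * z * p\<^sup>2 + 4 * q\<^sup>2 + f * t4)
      + 4 * (4 * p * q + f * t2) * (4 * p * q + f * t3) + 4 * (4 * p * q + f * t2)\<^sup>2
   = f * (4 * z * (8 * p\<^sup>2 * t1 + f * t1\<^sup>2)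
      - 8 * (4 * p\<^sup>2 * t4 + t1 * (2 * z * p\<^sup>2 + 4 * q\<^sup>2) + f * t1 * t4)
      + 4 * (4 * p * q * (t2 + t3) + f * t2 * t3) + 4 * (8 * p * q * t2 + f * t2\<^sup>2))"
  by (simp add: power2_eq_square algebra_simps)

lemma yv_identity3:
  fixes z a a1 a2 b b1 :: "'a::comm_ring_1"
  shows "(z*a\<^sup>2 - 4*(a*a2 - a1\<^sup>2)) * (2 * b)\<^sup>2 = 4 * z * (a * b)\<^sup>2 - 8 * (a * b) * (2 * (a2 * b + a1 * b1))
      + 4 * (2 * a1 * b) * (2 * a * b1) + 4 * (2 * a1 * b)\<^sup>2"
  by (simp add: power2_eq_square algebra_simps)

lemma yv_hirota_step:
  fixes a b f k :: "real poly"
  assumes W: "pderiv a * b - a * pderiv b = k * f\<^sup>2" and k: "pderiv k = 0"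
    and B: "pderiv (pderiv b) * f - 2 * pderiv b * pderiv f + b * pderiv (pderiv f) = 0"
    and b: "b \<noteq> 0"
  shows "pderiv (pderiv f) * a - 2 * pderiv f * pderiv a + f * pderiv (pderiv a) = 0"
proof -
  have "pderiv (pderiv a * b - a * pderiv b) = pderiv (k * f\<^sup>2)" using W by simp
  then have W': "pderiv (pderiv a) * b - a * pderiv (pderiv b) = 2 * k * f * pderiv f"
    using k by (simp add: pderiv_diff pderiv_mult power2_eq_square algebra_simps)
  have "b * (pderiv (pderiv f) * a - 2 * pderiv f * pderiv a + f * pderiv (pderiv a))
      = a * (pderiv (pderiv b) * f - 2 * pderiv b * pderiv f + b * pderiv (pderiv f))
        + f * (pderiv (pderiv a) * b - a * pderiv (pderiv b))
        - 2 * pderiv f * (pderiv a * b - a * pderiv b)"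
    by (simp add: algebra_simps)
  also have "\<dots> = 0"
    unfolding W W' B by (simp add: power2_eq_square algebra_simps)
  finally have "b * (pderiv (pderiv f) * a - 2 * pderiv f * pderiv a + f * pderiv (pderiv a)) = 0" .
  with b show ?thesis by simp
qed

lemma yv_wronskian_step:
  fixes a b c f k :: "real poly"
  assumes H: "a * b = yv_rhs f" and H2: "c * f = yv_rhs a"
    and W: "pderiv a * b - a * pderiv b = k * f\<^sup>2"
    and B: "pderiv (pderiv f) * a - 2 * pderiv f * pderiv a + f * pderiv (pderiv a) = 0"
    and nz: "a \<noteq> 0" "f \<noteq> 0"
  shows "pderiv c * f - c * pderiv f = (k + 2) * a\<^sup>2"
proof -
  define D where "D = pderiv c * f - c * pderiv f"
  have "pderiv (pderiv (pderiv f) * a - 2 * pderiv f * pderiv a + f * pderiv (pderiv a)) = 0"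
    using B by simp
  moreover have "pderiv (2 :: real poly) = 0" using pderiv_of_nat[of 2] by simp
  ultimately have B': "pderiv (pderiv (pderiv f)) * a - pderiv (pderiv f) * pderiv a
      - pderiv f * pderiv (pderiv a) + f * pderiv (pderiv (pderiv a)) = 0"
    by (simp add: pderiv_diff pderiv_add pderiv_mult algebra_simps)
  have "a * pderiv (a * b) - 2 * pderiv a * (a * b) = - a * (pderiv a * b - a * pderiv b)"
    unfolding pderiv_mult by (simp add: algebra_simps)
  then have E1: "a * pderiv (yv_rhs f) - 2 * pderiv a * yv_rhs f + k * f\<^sup>2 * a = 0"
    unfolding H[symmetric] W by (simp add: algebra_simps)
  have E2: "f * pderiv (yv_rhs a) - 2 * pderiv f * yv_rhs a = f * D"
    unfolding H2[symmetric] pderiv_mult D_def by (simp add: algebra_simps)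
  have "f * (f * (D - (k + 2) * a\<^sup>2)) = f * (f * D - (k + 2) * a\<^sup>2 * f)
      + a * (a * pderiv (yv_rhs f) - 2 * pderiv a * yv_rhs f + k * f\<^sup>2 * a)"
    unfolding E1 by (simp add: algebra_simps)
  also have "\<dots> = 4 * (pderiv (pderiv f) * a - 2 * pderiv f * pderiv a + f * pderiv (pderiv a))
        * (pderiv a * f + a * pderiv f)
      - 4 * (pderiv (pderiv (pderiv f)) * a - pderiv (pderiv f) * pderiv a
        - pderiv f * pderiv (pderiv a) + f * pderiv (pderiv (pderiv a))) * (a * f)"
    unfolding E2[symmetric] pderiv_yv_rhs unfolding yv_rhs_def by (rule yv_identity1)
  finally have "f * (f * (D - (k + 2) * a\<^sup>2)) = 0"
    unfolding B B' by simp
  with nz show ?thesis by (simp add: D_def)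
qed

lemma yv_dvd_step:
  fixes a b f k :: "real poly"
  assumes H: "a * b = yv_rhs f"
    and W: "pderiv a * b - a * pderiv b = k * f\<^sup>2" and k: "pderiv k = 0"
    and cop: "coprime b f"
  shows "f dvd yv_rhs a"
proof -
  define z p q r s where defs: "z = [:0, 1 :: real:]" "p = pderiv f" "q = pderiv p"
    "r = pderiv q" "s = pderiv r"
  define a1 a2 b1 b2 where defs': "a1 = pderiv a" "a2 = pderiv a1"
    "b1 = pderiv b" "b2 = pderiv b1"
  define t1 t2 t3 t4 where ts: "t1 = z * f - 4 * q"
    "t2 = f + 2 * z * p - 4 * r + k * f" "t3 = f + 2 * z * p - 4 * r - k * f"
    "t4 = 4 * p + 2 * z * q - 4 * s + 2 * k * p"
  have "pderiv (pderiv a * b - a * pderiv b) = pderiv (k * f\<^sup>2)" using W by simp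
  then have W': "a2 * b - a * b2 = 2 * k * f * p"
    using k by (simp add: defs defs' pderiv_diff pderiv_mult power2_eq_square algebra_simps)
  have P: "a * b = 4 * p\<^sup>2 + f * t1"
    unfolding H yv_rhs_def defs[symmetric] ts by (simp add: power2_eq_square algebra_simps)
  have "pderiv (a * b) = pderiv (yv_rhs f)" using H by simp
  then have 1: "a1 * b + a * b1 = f\<^sup>2 + 2 * z * f * p - 4 * (f * r - p * q)"
    unfolding pderiv_yv_rhs by (simp add: defs defs' pderiv_mult algebra_simps)
  have W0: "a1 * b - a * b1 = k * f\<^sup>2" using W by (simp add: defs')
  have "2 * a1 * b = (a1 * b + a * b1) + (a1 * b - a * b1)" by simp
  then have U: "2 * a1 * b = 4 * p * q + f * t2"
    unfolding 1 W0 ts by (simp add: power2_eq_square algebra_simps)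
  have "2 * a * b1 = (a1 * b + a * b1) - (a1 * b - a * b1)" by simp
  then have V: "2 * a * b1 = 4 * p * q + f * t3"
    unfolding 1 W0 ts by (simp add: power2_eq_square algebra_simps)
  have "pderiv (pderiv (a * b)) = pderiv (pderiv (yv_rhs f))" using H by simp
  then have 2: "a2 * b + 2 * a1 * b1 + a * b2
      = 4 * f * p + 2 * z * p\<^sup>2 + 2 * z * f * q - 4 * (f * s - q\<^sup>2)"
    unfolding pderiv2_yv_rhs
    by (simp add: defs defs' pderiv_mult pderiv_add algebra_simps)
  have "2 * (a2 * b + a1 * b1) = (a2 * b + 2 * a1 * b1 + a * b2) + (a2 * b - a * b2)"
    by (simp add: algebra_simps)
  then have T: "2 * (a2 * b + a1 * b1) = 2 * z * p\<^sup>2 + 4 * q\<^sup>2 + f * t4"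
    unfolding 2 W' ts by (simp add: power2_eq_square algebra_simps)
  have "yv_rhs a * (2 * b)\<^sup>2 = 4 * z * (a * b)\<^sup>2 - 8 * (a * b) * (2 * (a2 * b + a1 * b1))
      + 4 * (2 * a1 * b) * (2 * a * b1) + 4 * (2 * a1 * b)\<^sup>2"
    unfolding yv_rhs_def defs[symmetric] defs'[symmetric] by (rule yv_identity3)
  also have "\<dots> = f * (4 * z * (8 * p\<^sup>2 * t1 + f * t1\<^sup>2)
      - 8 * (4 * p\<^sup>2 * t4 + t1 * (2 * z * p\<^sup>2 + 4 * q\<^sup>2) + f * t1 * t4)
      + 4 * (4 * p * q * (t2 + t3) + f * t2 * t3) + 4 * (8 * p * q * t2 + f * t2\<^sup>2))"
    unfolding P U V T by (rule yv_identity2)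
  finally have "f dvd yv_rhs a * (2 * b)\<^sup>2" by simp
  moreover have "is_unit (2 :: real poly)"
    using is_unit_pCons_iff[of "2 :: real" 0] by (simp add: numeral_poly)
  then have "coprime f (2 * b)"
    using is_unit_right_imp_coprime[of 2 f] cop unfolding coprime_mult_right_iff
    by (simp add: coprime_commute)
  then have "coprime f ((2 * b)\<^sup>2)" unfolding coprime_power_right_iff by blast
  ultimately show ?thesis using coprime_dvd_mult_left_iff by blast
qed

lemma yv_coprime_step:
  fixes a b c f :: "real poly" and m :: real
  assumes H: "c * f = yv_rhs a"
    and W: "pderiv a * b - a * pderiv b = [:m:] * f\<^sup>2" and m: "m \<noteq> 0"
    and cop: "coprime f a"
  shows "coprime a c"
proof -
  have "coprime a (pderiv a)"
  proof (rule coprimeI)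
    fix d assume d: "d dvd a" "d dvd pderiv a"
    then have "d dvd pderiv a * b - a * pderiv b" by simp
    then have "d dvd f\<^sup>2" using m unfolding W by (simp add: dvd_smult_iff)
    moreover have "coprime (f\<^sup>2) a" using cop by simp
    ultimately show "is_unit d" using d(1) by (blast intro: coprime_common_divisor)
  qed
  then have cop2: "coprime a ((pderiv a)\<^sup>2)" by simp
  define z where "z = [:0, 1 :: real:]"
  show ?thesis
  proof (rule coprimeI)
    fix d assume d: "d dvd a" "d dvd c"
    then have "d dvd c * f - a * (z * a - 4 * pderiv (pderiv a))"
      by (intro dvd_diff dvd_mult2)
    also have "\<dots> = 4 * (pderiv a)\<^sup>2"
      unfolding H yv_rhs_def z_def[symmetric] by (simp add: power2_eq_square algebra_simps)
    also have "\<dots> = smult 4 ((pderiv a)\<^sup>2)" by (simp add: numeral_poly)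
    finally have "d dvd (pderiv a)\<^sup>2" by (simp add: dvd_smult_iff)
    with cop2 d(1) show "is_unit d" by (rule coprime_common_divisor)
  qed
qed

lemma yablonskii_vorobev_aux:
  fixes n :: nat
  defines "b \<equiv> yablonskii_vorobev n" and "f \<equiv> yablonskii_vorobev (Suc n)"
    and "a \<equiv> yablonskii_vorobev (Suc (Suc n))"
  shows "a * b = yv_rhs f \<and>
    pderiv a * b - a * pderiv b = [:2 * real n + 3:] * f\<^sup>2 \<and>
    pderiv (pderiv b) * f - 2 * pderiv b * pderiv f + b * pderiv (pderiv f) = 0 \<and>
    coprime b f \<and> coprime f a \<and> b \<noteq> 0 \<and> f \<noteq> 0 \<and> a \<noteq> 0"
  unfolding b_def f_def a_def
proof (induction n)
  case 0
  have a: "yv_rhs [:0, 1:] = [:4, 0, 0, 1:]"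
    by (simp add: yv_rhs_def pderiv_pCons power2_eq_square numeral_poly one_pCons)
  have "coprime [:0, 1:] ([:4, 0, 0, 1:] :: real poly)"
  proof (rule coprimeI)
    fix d :: "real poly" assume "d dvd [:0, 1:]" "d dvd [:4, 0, 0, 1:]"
    then have "d dvd [:4, 0, 0, 1:] - [:0, 1:] * [:0, 0, 1:]"
      by (meson dvd_diff dvd_mult2)
    then have "d dvd [:4:]" by simp
    moreover have "is_unit ([:4:] :: real poly)" by (simp add: is_unit_pCons_iff)
    ultimately show "is_unit d" using dvd_trans by blast
  qed
  then show ?case
    by (simp add: a pderiv_pCons power2_eq_square)
next
  case (Suc n)
  define b f a c where d: "b = yablonskii_vorobev n" "f = yablonskii_vorobev (Suc n)"
    "a = yablonskii_vorobev (Suc (Suc n))" "c = yablonskii_vorobev (Suc (Suc (Suc n)))"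
  define k where "k = [:2 * real n + 3:]"
  have k: "pderiv k = 0" by (simp add: k_def pderiv_pCons)
  from Suc have H: "a * b = yv_rhs f"
    and W: "pderiv a * b - a * pderiv b = k * f\<^sup>2"
    and B: "pderiv (pderiv b) * f - 2 * pderiv b * pderiv f + b * pderiv (pderiv f) = 0"
    and cop: "coprime b f" "coprime f a" and nz: "b \<noteq> 0" "f \<noteq> 0" "a \<noteq> 0"
    unfolding d[symmetric] k_def[symmetric] by (simp_all only: simp_thms)
  have "c = yv_rhs a div f" by (simp add: d)
  then have H2: "c * f = yv_rhs a" using yv_dvd_step[OF H W k cop(1)] by simp
  have B2: "pderiv (pderiv f) * a - 2 * pderiv f * pderiv a + f * pderiv (pderiv a) = 0"
    by (rule yv_hirota_step[OF W k B nz(1)])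
  have "pderiv c * f - c * pderiv f = (k + 2) * a\<^sup>2"
    by (rule yv_wronskian_step[OF H H2 W B2 nz(3,2)])
  moreover have "k + 2 = [:2 * real (Suc n) + 3:]" by (simp add: k_def numeral_poly)
  ultimately have W2: "pderiv c * f - c * pderiv f = [:2 * real (Suc n) + 3:] * a\<^sup>2" by simp
  have cop2: "coprime a c"
    by (rule yv_coprime_step[OF H2 W[unfolded k_def] _ cop(2)]) simp
  have "c \<noteq> 0"
  proof
    assume "c = 0"
    with W2 have "[:2 * real (Suc n) + 3:] * a\<^sup>2 = 0" by simp
    with nz show False by (simp add: add_eq_0_iff)
  qed
  then show ?case
    unfolding d[symmetric] by (intro conjI H2 W2 B2 cop(2) cop2 nz)
qed

theorem yablonskii_vorobev_recurrence:
  fixes n :: nat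
  assumes "n \<ge> 1"
  defines "Q \<equiv> yablonskii_vorobev"
  shows "Q (n + 1) * Q (n - 1) =
    [:0, 1:] * (Q n)\<^sup>2 - 4 * (Q n * pderiv (pderiv (Q n)) - (pderiv (Q n))\<^sup>2)"
  using yablonskii_vorobev_aux[of "n - 1"] assms by (simp add: yv_rhs_def)

lemma yablonskii_vorobev_nonzero: "yablonskii_vorobev n \<noteq> 0"
  using yablonskii_vorobev_aux[of n] by blast

theorem yablonskii_vorobev_unique:
  fixes Q :: "nat \<Rightarrow> real poly"
  assumes "Q 0 = 1" and "Q 1 = [:0, 1:]"
    and rec: "\<And>n. n \<ge> 1 \<Longrightarrow> Q (n + 1) * Q (n - 1) =
      [:0, 1:] * (Q n)\<^sup>2 - 4 * (Q n * pderiv (pderiv (Q n)) - (pderiv (Q n))\<^sup>2)"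
  shows "Q = yablonskii_vorobev"
proof
  fix n show "Q n = yablonskii_vorobev n"
  proof (induction n rule: yablonskii_vorobev.induct)
    case (3 n)
    have "Q (Suc (Suc n)) * Q n = yv_rhs (Q (Suc n))"
      using rec[of "Suc n"] by (simp add: yv_rhs_def)
    then have "Q (Suc (Suc n)) = yv_rhs (Q (Suc n)) div Q n"
      using 3 yablonskii_vorobev_nonzero[of n]
      by (metis nonzero_mult_div_cancel_right)
    with 3 show ?case by simp
  qed (use assms in simp_all)
qed

lemma finite_real_roots: "finite (real_roots n)"
  unfolding real_roots_def by (rule poly_roots_finite[OF yablonskii_vorobev_nonzero])

end

theory Submission
  imports Defs
begin

text \<open>The proof rests on the Wronskian identity
  \<open>Q\<^bsub>n+2\<^esub>' Q\<^sub>n - Q\<^bsub>n+2\<^esub> Q\<^sub>n' = (2n+3) Q\<^bsub>n+1\<^esub>\<^sup>2\<close>, where consecutive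
  polynomials have no common root. It says that the rational function \<open>Q\<^bsub>n+2\<^esub> / Q\<^sub>n\<close>
  increases strictly. On a bounded interval between neighbouring real roots of \<open>Q\<^sub>n\<close> it climbs
  from \<open>-\<infinity>\<close> to \<open>+\<infinity>\<close>; since \<open>deg Q\<^bsub>n+2\<^esub> + deg Q\<^sub>n = 2 deg Q\<^bsub>n+1\<^esub> + 1\<close> is odd,
  it does so on the two unbounded intervals as well. Each interval thus contains exactly one root
  of \<open>Q\<^bsub>n+2\<^esub>\<close>: there is one root more than \<open>Q\<^sub>n\<close> has, and the extreme ones lie outside the
  roots of \<open>Q\<^sub>n\<close>. The count follows by induction in steps of two from \<open>Q\<^sub>0 = 1\<close> and \<open>Q\<^sub>1 = z\<close>.

  The Wronskian enters through its sign at the roots of the two polynomials, where one of its two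
  terms vanishes. The rest is the intermediate value theorem for polynomials
  (\<open>root_between_roots\<close>, \<open>root_right_of_all_roots\<close>, \<open>root_left_of_all_roots\<close>) and a count of
  two interlaced finite sets (\<open>card_interlaced\<close>).\<close>

section \<open>Counting interlaced finite sets\<close>

text \<open>By induction on \<open>B\<close>: beyond the last element of \<open>B\<close> there is exactly one element of \<open>A\<close>,
  and deleting these two leaves an interlaced pair of the same kind.\<close>

lemma card_interlaced:
  fixes A B :: "'a::linorder set"
  assumes "finite B" and "finite A"
    and "\<And>x y. x \<in> A \<Longrightarrow> y \<in> A \<Longrightarrow> x < y \<Longrightarrow> \<exists>b\<in>B. x < b \<and> b < y"
    and "\<And>x y. x \<in> B \<Longrightarrow> y \<in> B \<Longrightarrow> x < y \<Longrightarrow> \<exists>a\<in>A. x < a \<and> a < y"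
    and "\<exists>a\<in>A. \<forall>b\<in>B. a < b" and "\<exists>a\<in>A. \<forall>b\<in>B. b < a"
  shows "card A = Suc (card B)"
  using assms
proof (induction B arbitrary: A rule: finite_linorder_max_induct)
  case empty
  then obtain a where "a \<in> A" by blast
  moreover have "x = a" if "x \<in> A" for x
    using empty.prems(2)[of x a] empty.prems(2)[of a x] that \<open>a \<in> A\<close>
    by (cases x a rule: linorder_cases) auto
  ultimately have "A = {a}" by blast
  then show ?case by simp
next
  case (insert m B A)
  from insert.prems(5) obtain a where a: "a \<in> A" "m < a" by blast
  have last: "a' \<le> m" if "a' \<in> A - {a}" for a'
  proof (rule ccontr)
    assume "\<not> a' \<le> m"
    with that a insert.prems(2)[of a a'] insert.prems(2)[of a' a] insert.hyps(2) show False
      by (cases a a' rule: linorder_cases) force+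
  qed
  have "card (A - {a}) = Suc (card B)"
  proof (rule insert.IH)
    show "finite (A - {a})" using insert.prems by simp
    show "\<exists>b\<in>B. x < b \<and> b < y" if "x \<in> A - {a}" "y \<in> A - {a}" "x < y" for x y
      using insert.prems(2)[of x y] that last[of y] by force
    show "\<exists>a'\<in>A - {a}. x < a' \<and> a' < y" if "x \<in> B" "y \<in> B" "x < y" for x y
      using insert.prems(3)[of x y] that insert.hyps(2) a by force
    show "\<exists>a'\<in>A - {a}. \<forall>b\<in>B. a' < b"
      using insert.prems(4) a by force
    show "\<exists>a'\<in>A - {a}. \<forall>b\<in>B. b < a'"
    proof (cases "B = {}")
      case True
      with insert.prems(4) a show ?thesis by force
    next
      case False
      with insert.hyps have M: "Max B \<in> B" "Max B < m" by auto
      then obtain a' where "a' \<in> A" "Max B < a'" "a' < m"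
        using insert.prems(3)[of "Max B" m] by auto
      moreover from this have "\<forall>b\<in>B. b < a'"
        using Max_ge[OF insert.hyps(1)] by (meson le_less_trans)
      ultimately have "a' \<in> A - {a}" "\<forall>b\<in>B. b < a'"
        using a by auto
      then show ?thesis by blast
    qed
  qed
  moreover have "card A = Suc (card (A - {a}))"
    using a insert.prems(1) by (metis card_Suc_Diff1)
  moreover have "m \<notin> B" using insert.hyps(2) by blast
  ultimately show ?case using insert.hyps(1) by simp
qed


section \<open>Real polynomials with positive Wronskian at their roots\<close>

text \<open>Between neighbouring simple roots of \<open>p\<close> the derivative \<open>p'\<close> changes sign, so \<open>q\<close>, which
  has the sign of \<open>p'\<close> at the roots of \<open>p\<close>, changes sign too.\<close>

lemma root_between_roots:
  fixes p q :: "real poly"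
  assumes sign: "\<And>x. poly p x = 0 \<Longrightarrow> poly (pderiv p) x * poly q x > 0"
    and x: "poly p x = 0" and y: "poly p y = 0" and "x < y"
  shows "\<exists>z. x < z \<and> z < y \<and> poly q z = 0"
proof -
  have "p \<noteq> 0" using sign[of x] by auto
  define S where "S = {t. poly p t = 0 \<and> x < t \<and> t \<le> y}"
  have "finite S" unfolding S_def
    by (rule finite_subset[OF _ poly_roots_finite[OF \<open>p \<noteq> 0\<close>]]) blast
  moreover have "y \<in> S" using y \<open>x < y\<close> by (simp add: S_def)
  ultimately obtain w where "w \<in> S" and least: "\<And>t. t \<in> S \<Longrightarrow> w \<le> t"
    using Min_in[of S] Min_le[of S] by blast
  then have w: "poly p w = 0" "x < w" "w \<le> y" by (simp_all add: S_def)
  have none: "poly p t \<noteq> 0" if "x < t" "t < w" for t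
    using least[of t] that w by (force simp: S_def)
  (* Splitting off both roots turns the signs of p' at x and w into signs of the cofactor r. *)
  from x obtain s where s: "p = [:- x, 1:] * s" by (auto simp: poly_eq_0_iff_dvd)
  with w have "poly s w = 0" by auto
  then obtain r where r: "s = [:- w, 1:] * r" by (auto simp: poly_eq_0_iff_dvd)
  have p: "p = [:- x, 1:] * ([:- w, 1:] * r)" using r s by simp
  have d: "poly (pderiv p) x = (x - w) * poly r x" "poly (pderiv p) w = (w - x) * poly r w"
    unfolding p pderiv_mult by (simp_all add: pderiv_pCons algebra_simps)
  show ?thesis
  proof (cases "poly q x * poly q w < 0")
    case True
    from poly_IVT[OF w(2) this] w show ?thesis by force
  next
    case False
    (* Now q has equal signs at x and w, so p' has too, and r has a root in between: it would be
       a root of p. *)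
    with sign[OF x] sign[OF w(1)] have "poly q x * poly q w > 0"
      by (metis linorder_neqE_linordered_idom mult_eq_0_iff less_irrefl)
    moreover have "(poly (pderiv p) x * poly (pderiv p) w) * (poly q x * poly q w) > 0"
      using mult_pos_pos[OF sign[OF x] sign[OF w(1)]] by (simp add: mult_ac)
    ultimately have "poly (pderiv p) x * poly (pderiv p) w > 0"
      using zero_less_mult_pos2 by blast
    moreover have "poly (pderiv p) x * poly (pderiv p) w = - (w - x)\<^sup>2 * (poly r x * poly r w)"
      unfolding d by (simp add: power2_eq_square algebra_simps)
    ultimately have "poly r x * poly r w < 0"
      using w(2) by (simp add: mult_less_0_iff zero_less_mult_iff)
    from poly_IVT[OF w(2) this] none show ?thesis unfolding p by force
  qed
qed

lemma root_right_of_negative_value: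
  fixes p :: "real poly"
  assumes "lead_coeff p > 0" and "poly p a < 0"
  shows "\<exists>x>a. poly p x = 0"
proof -
  obtain n where n: "\<And>x. x \<ge> n \<Longrightarrow> lead_coeff p \<le> poly p x"
    using poly_pinfty_gt_lc[OF assms(1)] by blast
  have "poly p (max n (a + 1)) > 0" using n[of "max n (a + 1)"] assms(1) by linarith
  with assms(2) poly_IVT_pos[of a "max n (a + 1)" p] show ?thesis by force
qed

text \<open>At the largest root of \<open>q\<close> the derivative \<open>q'\<close> is positive, since \<open>q\<close> is positive beyond it;
  there \<open>p\<close> has the opposite sign, and must still climb to \<open>+\<infinity>\<close>.\<close>

lemma root_right_of_all_roots:
  fixes p q :: "real poly"
  assumes lc: "lead_coeff p > 0" "lead_coeff q > 0"
    and sign: "\<And>x. poly q x = 0 \<Longrightarrow> poly p x * poly (pderiv q) x < 0"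
    and x: "poly q x = 0"
  shows "\<exists>a. poly p a = 0 \<and> (\<forall>b. poly q b = 0 \<longrightarrow> b < a)"
proof -
  define S where "S = {t. poly q t = 0}"
  have "q \<noteq> 0" using lc(2) by auto
  then have "finite S" "x \<in> S" using x poly_roots_finite[of q] by (simp_all add: S_def)
  then have "Max S \<in> S" and le: "\<And>b. poly q b = 0 \<Longrightarrow> b \<le> Max S"
    using Max_in[of S] Max_ge[of S] by (auto simp: S_def)
  define M where "M = Max S"
  have M: "poly q M = 0" using \<open>Max S \<in> S\<close> by (simp add: S_def M_def)
  then obtain r where r: "q = [:- M, 1:] * r" by (auto simp: poly_eq_0_iff_dvd)
  have "poly (pderiv q) M = poly r M"
    unfolding r pderiv_mult by (simp add: pderiv_pCons)
  moreover have "\<not> poly r M < 0"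
  proof
    assume "poly r M < 0"
    moreover have "lead_coeff r > 0" using lc(2) unfolding r lead_coeff_mult by simp
    ultimately obtain t where "t > M" "poly r t = 0"
      using root_right_of_negative_value by blast
    with le[of t] show False by (simp add: r M_def)
  qed
  ultimately have "poly p M < 0" using sign[OF M] by (auto simp: mult_less_0_iff)
  with lc(1) obtain a where "a > M" "poly p a = 0" using root_right_of_negative_value by blast
  with le show ?thesis unfolding M_def by force
qed

text \<open>The sign factor keeps the leading coefficient, so that statements about \<open>+\<infinity>\<close> which assume
  it to be positive carry over to \<open>-\<infinity>\<close>.\<close>

definition reflection :: "real poly \<Rightarrow> real poly" where
  "reflection p = smult ((- 1) ^ degree p) (pcompose p [:0, - 1:])"

lemma lead_coeff_reflection: "lead_coeff (reflection p) = lead_coeff p"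
proof -
  have "lead_coeff (pcompose p [:0, - 1:]) = lead_coeff p * (- 1) ^ degree p"
    by (subst lead_coeff_comp) simp_all
  moreover have "(- 1 :: real) ^ degree p * (- 1) ^ degree p = 1"
    by (simp flip: power_mult_distrib)
  ultimately show ?thesis unfolding reflection_def lead_coeff_smult by (simp add: mult_ac)
qed

lemma poly_reflection: "poly (reflection p) x = (- 1) ^ degree p * poly p (- x)"
  by (simp add: reflection_def poly_pcompose)

lemma poly_pderiv_reflection:
  "poly (pderiv (reflection p)) x = - ((- 1) ^ degree p * poly (pderiv p) (- x))"
  by (simp add: reflection_def pderiv_smult pderiv_pcompose poly_pcompose pderiv_pCons)

text \<open>Reflection exchanges left and right. It changes the sign of \<open>p q'\<close> once through the chain
  rule and once more through the normalising factors, because the sum of the degrees is odd.\<close>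

lemma root_left_of_all_roots:
  fixes p q :: "real poly"
  assumes lc: "lead_coeff p > 0" "lead_coeff q > 0" and odd: "odd (degree p + degree q)"
    and sign: "\<And>x. poly q x = 0 \<Longrightarrow> poly p x * poly (pderiv q) x < 0"
    and x: "poly q x = 0"
  shows "\<exists>a. poly p a = 0 \<and> (\<forall>b. poly q b = 0 \<longrightarrow> a < b)"
proof -
  have "\<exists>a. poly (reflection p) a = 0 \<and> (\<forall>b. poly (reflection q) b = 0 \<longrightarrow> b < a)"
  proof (rule root_right_of_all_roots)
    show "poly (reflection q) (- x) = 0" using x by (simp add: poly_reflection)
    fix t assume "poly (reflection q) t = 0"
    then have "poly p (- t) * poly (pderiv q) (- t) < 0"
      by (intro sign) (simp add: poly_reflection)
    moreover have "poly (reflection p) t * poly (pderiv (reflection q)) t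
        = - ((- 1) ^ (degree p + degree q)) * (poly p (- t) * poly (pderiv q) (- t))"
      unfolding poly_reflection poly_pderiv_reflection by (simp add: power_add mult_ac)
    ultimately show "poly (reflection p) t * poly (pderiv (reflection q)) t < 0"
      using odd by simp
  qed (use lc in \<open>simp_all add: lead_coeff_reflection\<close>)
  then obtain a where "poly p (- a) = 0" "\<And>b. poly q (- b) = 0 \<Longrightarrow> b < a"
    by (auto simp: poly_reflection)
  then show ?thesis by (metis minus_less_iff minus_minus)
qed

lemma odd_degree_imp_root:
  fixes p :: "real poly"
  assumes "odd (degree p)" "lead_coeff p > 0"
  shows "\<exists>x. poly p x = 0"
proof -
  obtain n where n: "\<And>x. x \<ge> n \<Longrightarrow> lead_coeff p \<le> poly (reflection p) x"
    using poly_pinfty_gt_lc[of "reflection p"] assms(2) unfolding lead_coeff_reflection by blast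
  have "poly p (- n) < 0" using n[of n] assms by (simp add: poly_reflection)
  with root_right_of_negative_value assms(2) show ?thesis by blast
qed

text \<open>At a root of \<open>p\<close> the Wronskian is \<open>p' q\<close>, at a root of \<open>q\<close> it is \<open>- p q'\<close>. The
  two roles are therefore symmetric up to replacing \<open>(p, q)\<close> by \<open>(q, - p)\<close>, and roots of each
  separate those of the other. The positive sign together with the positive leading coefficients
  decides that both outermost roots belong to \<open>p\<close>.\<close>

theorem positive_wronskian_interlacing:
  fixes p q :: "real poly"
  assumes lc: "lead_coeff p > 0" "lead_coeff q > 0" and odd: "odd (degree p + degree q)"
    and wronskian: "\<And>x. poly p x = 0 \<or> poly q x = 0 \<Longrightarrow> poly (pderiv p * q - p * pderiv q) x > 0"
  shows "card {x. poly p x = 0} = Suc (card {x. poly q x = 0})"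
    and "\<exists>a. poly p a = 0 \<and> (\<forall>b. poly q b = 0 \<longrightarrow> a < b)"
    and "\<exists>a. poly p a = 0 \<and> (\<forall>b. poly q b = 0 \<longrightarrow> b < a)"
proof -
  have p: "poly (pderiv p) x * poly q x > 0" if "poly p x = 0" for x
    using wronskian[of x] that by simp
  have q: "poly p x * poly (pderiv q) x < 0" if "poly q x = 0" for x
    using wronskian[of x] that by simp
  have q': "poly (pderiv q) x * poly (- p) x > 0" if "poly q x = 0" for x
    using q[OF that] by (simp add: mult.commute)
  (* If q has no root, its degree is even and that of p is odd, so any root of p will do. *)
  have root: "\<exists>x. poly p x = 0" if "\<nexists>x. poly q x = 0"
    using odd_degree_imp_root[of p] odd_degree_imp_root[of q] that lc odd by auto
  show left: "\<exists>a. poly p a = 0 \<and> (\<forall>b. poly q b = 0 \<longrightarrow> a < b)"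
    using root_left_of_all_roots[OF lc odd q] root by blast
  show right: "\<exists>a. poly p a = 0 \<and> (\<forall>b. poly q b = 0 \<longrightarrow> b < a)"
    using root_right_of_all_roots[OF lc q] root by blast
  show "card {x. poly p x = 0} = Suc (card {x. poly q x = 0})"
  proof (rule card_interlaced)
    show "finite {x. poly p x = 0}" "finite {x. poly q x = 0}"
      using lc by (auto intro!: poly_roots_finite)
    show "\<exists>b\<in>{x. poly q x = 0}. x < b \<and> b < y"
      if "x \<in> {x. poly p x = 0}" "y \<in> {x. poly p x = 0}" "x < y" for x y
      using root_between_roots[of p q x y] p that by blast
    show "\<exists>a\<in>{x. poly p x = 0}. x < a \<and> a < y"
      if "x \<in> {x. poly q x = 0}" "y \<in> {x. poly q x = 0}" "x < y" for x y
      using root_between_roots[of q "- p" x y] q' that by auto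
  qed (use left right in auto)
qed


section \<open>Yablonskii--Vorob'ev polynomials\<close>

text \<open>The term \<open>z f\<^sup>2\<close> dominates: the others have degree at most \<open>2 deg f\<close>.\<close>

lemma yv_rhs_leading:
  assumes "f \<noteq> 0"
  shows "degree (yv_rhs f) = 2 * degree f + 1" and "lead_coeff (yv_rhs f) = (lead_coeff f)\<^sup>2"
proof -
  define g where "g = - (4 * (f * pderiv (pderiv f) - (pderiv f)\<^sup>2))"
  have rhs: "yv_rhs f = g + [:0, 1:] * f\<^sup>2" by (simp add: yv_rhs_def g_def)
  have "degree (f * pderiv (pderiv f)) \<le> 2 * degree f"
    using degree_mult_le[of f "pderiv (pderiv f)"] by (simp add: degree_pderiv)
  moreover have "degree ((pderiv f)\<^sup>2) \<le> 2 * degree f"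
    using degree_power_le[of "pderiv f" 2] by (simp add: degree_pderiv)
  ultimately have "degree g \<le> 2 * degree f"
    unfolding g_def by (simp add: numeral_poly degree_diff_le)
  moreover have deg: "degree ([:0, 1:] * f\<^sup>2) = 2 * degree f + 1"
    using assms by (subst degree_mult_eq) (simp_all add: degree_power_eq)
  ultimately have less: "degree g < degree ([:0, 1:] * f\<^sup>2)" by simp
  show "degree (yv_rhs f) = 2 * degree f + 1"
    unfolding rhs degree_add_eq_right[OF less] by (rule deg)
  show "lead_coeff (yv_rhs f) = (lead_coeff f)\<^sup>2"
    unfolding rhs lead_coeff_add_le[OF less] lead_coeff_mult lead_coeff_power by simp
qed

lemma odd_degree_yablonskii_vorobev:
  "odd (degree (yablonskii_vorobev (Suc (Suc n))) + degree (yablonskii_vorobev n))"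
proof -
  have "degree (yablonskii_vorobev (Suc (Suc n)) * yablonskii_vorobev n)
      = 2 * degree (yablonskii_vorobev (Suc n)) + 1"
    using yablonskii_vorobev_aux[of n] yv_rhs_leading(1) by metis
  then show ?thesis
    using degree_mult_eq[OF yablonskii_vorobev_nonzero yablonskii_vorobev_nonzero, of "Suc (Suc n)" n]
    by (metis even_mult_iff even_plus_one_iff even_numeral)
qed

lemma lead_coeff_yablonskii_vorobev_pos: "lead_coeff (yablonskii_vorobev n) > 0"
proof (induction n rule: induct_nat_012)
  case (ge2 n)
  have "lead_coeff (yablonskii_vorobev (Suc (Suc n))) * lead_coeff (yablonskii_vorobev n)
      = (lead_coeff (yablonskii_vorobev (Suc n)))\<^sup>2"
    unfolding lead_coeff_mult[symmetric] using yablonskii_vorobev_aux[of n] yv_rhs_leading(2) by metis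
  also have "\<dots> > 0" using ge2(2) by (rule zero_less_power)
  finally show ?case using ge2 by (simp add: zero_less_mult_iff del: yablonskii_vorobev.simps)
qed simp_all

lemma wronskian_yablonskii_vorobev_pos:
  fixes n :: nat
  defines "p \<equiv> yablonskii_vorobev (Suc (Suc n))" and "q \<equiv> yablonskii_vorobev n"
  assumes "poly p x = 0 \<or> poly q x = 0"
  shows "poly (pderiv p * q - p * pderiv q) x > 0"
proof -
  have "poly (yablonskii_vorobev (Suc n)) x \<noteq> 0"
    using assms(3) yablonskii_vorobev_aux[of n] coprime_poly_0 unfolding p_def q_def by metis
  moreover have "pderiv p * q - p * pderiv q
      = [:2 * real n + 3:] * (yablonskii_vorobev (Suc n))\<^sup>2"
    using yablonskii_vorobev_aux[of n] unfolding p_def q_def by blast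
  ultimately show ?thesis by simp
qed

lemmas yablonskii_vorobev_interlacing =
  positive_wronskian_interlacing[OF lead_coeff_yablonskii_vorobev_pos
    lead_coeff_yablonskii_vorobev_pos odd_degree_yablonskii_vorobev wronskian_yablonskii_vorobev_pos]

lemma card_real_roots: "card (real_roots n) = (n + 1) div 2"
proof (induction n rule: induct_nat_012)
  case (ge2 n)
  have "card (real_roots (Suc (Suc n))) = Suc (card (real_roots n))"
    unfolding real_roots_def by (rule yablonskii_vorobev_interlacing(1))
  with ge2 show ?case by simp
qed (simp_all add: real_roots_def)

lemma extreme_real_roots:
  assumes "real_roots n \<noteq> {}"
  shows "Min (real_roots (Suc (Suc n))) < Min (real_roots n)"
    and "Max (real_roots n) < Max (real_roots (Suc (Suc n)))"
proof -
  have ends: "Min (real_roots n) \<in> real_roots n" "Max (real_roots n) \<in> real_roots n"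
    using assms finite_real_roots by auto
  obtain a where "a \<in> real_roots (Suc (Suc n))" "a < Min (real_roots n)"
    using yablonskii_vorobev_interlacing(2)[of n] ends(1) unfolding real_roots_def by blast
  then show "Min (real_roots (Suc (Suc n))) < Min (real_roots n)"
    using Min_le[OF finite_real_roots] by (meson le_less_trans)
  obtain a where "a \<in> real_roots (Suc (Suc n))" "Max (real_roots n) < a"
    using yablonskii_vorobev_interlacing(3)[of n] ends(2) unfolding real_roots_def by blast
  then show "Max (real_roots n) < Max (real_roots (Suc (Suc n)))"
    using Max_ge[OF finite_real_roots] by (meson less_le_trans)
qed

theorem theorem2:
  "(\<forall>n::nat. int (card (real_roots n)) = \<lfloor>(real n + 1) / 2\<rfloor>) \<and>
   (\<forall>n::nat. n \<ge> 2 \<longrightarrow>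
      Min (real_roots (n - 1)) > Min (real_roots (n + 1)) \<and>
      Max (real_roots (n - 1)) < Max (real_roots (n + 1)))"
proof (intro conjI allI impI)
  fix n :: nat
  show "int (card (real_roots n)) = \<lfloor>(real n + 1) / 2\<rfloor>"
    using floor_divide_of_nat_eq[of "n + 1" 2, where ?'a = real]
    by (simp add: card_real_roots add.commute)
next
  fix n :: nat
  assume "n \<ge> 2"
  then obtain m where m: "n = Suc m" "m \<ge> 1" by (cases n) auto
  then have "card (real_roots m) \<noteq> 0" unfolding card_real_roots by simp
  then have "real_roots m \<noteq> {}" by auto
  from extreme_real_roots[OF this] m
  show "Min (real_roots (n - 1)) > Min (real_roots (n + 1))"
    and "Max (real_roots (n - 1)) < Max (real_roots (n + 1))" by simp_all
qed

end
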